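(* Let $\perp$ be the polarity of $\mathbb{F}_q^n$ associated with either a non-degenerate Hermitian form ($q$ a square) or a non-degenerate quadratic form with $q$ odd, so that the associated polar space is one of $O^+(2d,q)$, $U(2d,\sqrt q)$, $U(2d+1,\sqrt q)$, $O(2d+1,q)$, $O^-(2d+2,q)$, of rank $d\ge 3$. Let $\Gamma$ be the polarity graph. Let $3\le m\le d$ and let $L_1,L_2$ be $(m-1)$-dimensional subspaces which are not totally isotropic, such that $L_1\cap L_2$ has dimension $m-2$ and equals the radical of $L_1$ and the radical of $L_2$, i.e. $L_1\cap L_2=L_1\cap L_1^\perp=L_2\cap L_2^\perp$. Let $C_1$ be the set of non-isotropic points of $L_1$ not contained in $L_2$, and $C_2$ the set of non-isotropic points of $L_2$ not contained in $L_1$. Then $\{C_1,C_2\}$ is a switching set of $\Gamma$.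
   Context: Points are $1$-dimensional subspaces of $\mathbb{F}_q^n$; a point $x$ is isotropic if $x\subseteq x^\perp$. The polarity graph $\Gamma$ has the non-isotropic points as vertices, two points $x,y$ adjacent iff $x\subseteq y^\perp$. The rank is the dimension of a maximal totally isotropic subspace. For a vertex $x$, $\Gamma(x)$ is its neighbourhood. For disjoint vertex sets $C_1,C_2$ with $D$ the remaining vertices: $\{C_1,C_2\}$ is a switching set if $|C_1|=|C_2|$, the induced subgraphs on $C_1$, $C_2$, $C_1\cup C_2$ are regular with equal degrees on $C_1$ and $C_2$, and every $x\in D$ satisfies $|\Gamma(x)\cap C_1|=|\Gamma(x)\cap C_2|$ or $\Gamma(x)\cap(C_1\cup C_2)\in\{C_1,C_2\}$. *)

theory Defs
  imports "HOL-Analysis.Cartesian_Space"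
begin

section \<open>Forms over a finite field\<close>

text \<open>The field is the type \<open>'a\<close>, so \<open>q = CARD('a)\<close>, and the vector space is \<open>'a ^ 'n\<close>,
  so \<open>n = CARD('n)\<close>.\<close>

type_synonym ('a, 'n) form = "'a ^ 'n \<Rightarrow> 'a ^ 'n \<Rightarrow> 'a"

text \<open>Since \<open>q = r\<^sup>2\<close>, the map \<open>c \<mapsto> c ^ r\<close> is the field automorphism of order two;
  semilinearity in the second argument follows from the last clause.\<close>

definition hermitian_form :: "nat \<Rightarrow> ('a::{field,finite}, 'n::finite) form \<Rightarrow> bool" where
  "hermitian_form r h \<longleftrightarrow>
     CARD('a) = r ^ 2 \<and>
     (\<forall>y. Vector_Spaces.linear (*s) (*) (\<lambda>x. h x y)) \<and>
     (\<forall>x y. h y x = h x y ^ r)"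

definition polar_form :: "('a::field ^ 'n::finite \<Rightarrow> 'a) \<Rightarrow> ('a, 'n) form" where
  "polar_form Q = (\<lambda>x y. Q (x + y) - Q x - Q y)"

text \<open>The polar form is symmetric, so linearity in one argument gives bilinearity.\<close>

definition quadratic_form :: "('a::field ^ 'n::finite \<Rightarrow> 'a) \<Rightarrow> bool" where
  "quadratic_form Q \<longleftrightarrow>
     (\<forall>c x. Q (c *s x) = c ^ 2 * Q x) \<and>
     (\<forall>y. Vector_Spaces.linear (*s) (*) (\<lambda>x. polar_form Q x y))"

definition nondegenerate :: "('a::field, 'n::finite) form \<Rightarrow> bool" where
  "nondegenerate B \<longleftrightarrow> (\<forall>x. (\<forall>y. B x y = 0) \<longrightarrow> x = 0)"

definition perp :: "('a::field, 'n::finite) form \<Rightarrow> ('a ^ 'n) set \<Rightarrow> ('a ^ 'n) set" where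
  "perp B U = {v. \<forall>u\<in>U. B u v = 0}"

definition totally_isotropic :: "('a::field, 'n::finite) form \<Rightarrow> ('a ^ 'n) set \<Rightarrow> bool" where
  "totally_isotropic B U \<longleftrightarrow> vec.subspace U \<and> U \<subseteq> perp B U"

definition polar_rank :: "('a::{field,finite}, 'n::finite) form \<Rightarrow> nat" where
  "polar_rank B = Max (vec.dim ` {U. totally_isotropic B U})"

text \<open>The form \<open>B\<close> defines a polar space of rank \<open>d\<close> of type \<open>U(2d, \<surd>q)\<close> or \<open>U(2d+1, \<surd>q)\<close>
  in the Hermitian case, and of type \<open>O\<^sup>+(2d, q)\<close>, \<open>O(2d+1, q)\<close> or \<open>O\<^sup>-(2d+2, q)\<close>
  in the quadratic case: within each case the type is determined by the rank and by
  the dimension \<open>n\<close>. In the quadratic case \<open>q\<close> is odd, so non-degeneracy of the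
  quadratic form is that of its polar form.\<close>

definition classical_polar_space :: "nat \<Rightarrow> ('a::{field,finite}, 'n::finite) form \<Rightarrow> bool" where
  "classical_polar_space d B \<longleftrightarrow>
     nondegenerate B \<and> polar_rank B = d \<and>
     ((\<exists>r. hermitian_form r B) \<and> CARD('n) \<in> {2 * d, 2 * d + 1} \<or>
      odd CARD('a) \<and> (\<exists>Q. quadratic_form Q \<and> B = polar_form Q) \<and>
        CARD('n) \<in> {2 * d, 2 * d + 1, 2 * d + 2})"


section \<open>The polarity graph\<close>

definition points :: "('a::field ^ 'n::finite) set set" where
  "points = {x. vec.subspace x \<and> vec.dim x = 1}"

definition isotropic_point :: "('a::field, 'n::finite) form \<Rightarrow> ('a ^ 'n) set \<Rightarrow> bool" where
  "isotropic_point B x \<longleftrightarrow> x \<in> points \<and> x \<subseteq> perp B x"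

definition polarity_verts :: "('a::field, 'n::finite) form \<Rightarrow> ('a ^ 'n) set set" where
  "polarity_verts B = {x \<in> points. \<not> isotropic_point B x}"

definition polarity_adj :: "('a::field, 'n::finite) form \<Rightarrow> ('a ^ 'n) set \<Rightarrow> ('a ^ 'n) set \<Rightarrow> bool" where
  "polarity_adj B x y \<longleftrightarrow> x \<in> polarity_verts B \<and> y \<in> polarity_verts B \<and> x \<subseteq> perp B y"


section \<open>Switching sets of a graph with vertex set \<open>V\<close> and adjacency relation \<open>E\<close>\<close>

definition nbhd :: "'v set \<Rightarrow> ('v \<Rightarrow> 'v \<Rightarrow> bool) \<Rightarrow> 'v \<Rightarrow> 'v set" where
  "nbhd V E x = {y \<in> V. E x y}"

definition induced_regular :: "'v set \<Rightarrow> ('v \<Rightarrow> 'v \<Rightarrow> bool) \<Rightarrow> 'v set \<Rightarrow> nat \<Rightarrow> bool" where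
  "induced_regular V E C k \<longleftrightarrow> (\<forall>x\<in>C. card (nbhd V E x \<inter> C) = k)"

definition switching_set :: "'v set \<Rightarrow> ('v \<Rightarrow> 'v \<Rightarrow> bool) \<Rightarrow> 'v set \<Rightarrow> 'v set \<Rightarrow> bool" where
  "switching_set V E C1 C2 \<longleftrightarrow>
     C1 \<subseteq> V \<and> C2 \<subseteq> V \<and> C1 \<inter> C2 = {} \<and>
     card C1 = card C2 \<and>
     (\<exists>k. induced_regular V E C1 k \<and> induced_regular V E C2 k) \<and>
     (\<exists>l. induced_regular V E (C1 \<union> C2) l) \<and>
     (\<forall>x \<in> V - (C1 \<union> C2).
        card (nbhd V E x \<inter> C1) = card (nbhd V E x \<inter> C2) \<or>
        nbhd V E x \<inter> (C1 \<union> C2) \<in> {C1, C2})"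

end

theory Submission
  imports Defs
begin

text \<open>Write \<open>R = L1 \<inter> L2\<close> and \<open>L\<^sub>i = R \<oplus> \<langle>p\<^sub>i\<rangle>\<close>. As \<open>R\<close> is the radical of \<open>L\<^sub>i\<close>, every vector of
  \<open>L\<^sub>i\<close> outside \<open>R\<close> is non-isotropic, so the points of \<open>C\<^sub>i\<close> are exactly the \<open>\<langle>p\<^sub>i + r\<rangle>\<close> with
  \<open>r \<in> R\<close>, without repetition. Adjacency between such points depends only on the values of the
  form at the \<open>p\<^sub>i\<close>, so each \<open>C\<^sub>i\<close> is edgeless and all or no edges run between \<open>C1\<close> and \<open>C2\<close>.
  A vertex \<open>\<langle>v\<rangle>\<close> is adjacent to \<open>\<langle>p\<^sub>i + r\<rangle>\<close> iff \<open>B r v = - B p\<^sub>i v\<close>. If \<open>v\<close> is orthogonal to \<open>R\<close>,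
  this does not depend on \<open>r\<close>; otherwise it holds for \<open>|R| / q\<close> elements \<open>r\<close> of \<open>R\<close>, for both \<open>i\<close>.\<close>

section \<open>Points, vertices and adjacency for a reflexive form\<close>

lemma points_iff: "x \<in> points \<longleftrightarrow> (\<exists>v::'a::field ^ 'n::finite. v \<noteq> 0 \<and> x = vec.span {v})"
proof
  assume "x \<in> points"
  then have x: "vec.subspace x" "vec.dim x = 1" by (auto simp: points_def)
  obtain b where b: "b \<subseteq> x" "vec.independent b" "x \<subseteq> vec.span b" "card b = 1"
    using vec.basis_exists[of x] x(2) by metis
  then obtain v where v: "b = {v}" using card_1_singletonE by blast
  have "v \<noteq> 0" using b v vec.dependent_zero[of "{v}"] by auto
  moreover have "x = vec.span {v}"
    using b v x(1) vec.span_minimal[of b x] by blast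
  ultimately show "\<exists>v. v \<noteq> 0 \<and> x = vec.span {v}" by blast
next
  assume "\<exists>v. v \<noteq> 0 \<and> x = vec.span {v}"
  then obtain v where v: "v \<noteq> 0" "x = vec.span {v}" by blast
  then have "vec.independent {v}" by simp
  then have "vec.dim (vec.span {v}) = 1"
    by (metis One_nat_def card.empty card.insert empty_iff finite.emptyI vec.dim_span_eq_card_independent)
  then show "x \<in> points" using v by (simp add: points_def)
qed

text \<open>Treats the Hermitian form and the polar form of a quadratic form together. A Hermitian
  form is only semilinear in its second argument, so facts about that argument are obtained by
  swapping the arguments, under which only the vanishing of a value is known to persist.\<close>

locale reflexive_form =
  fixes B :: "('a::field, 'n::finite) form"
  assumes linear_left: "Vector_Spaces.linear (*s) (*) (\<lambda>x. B x y)"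
    and reflexive: "B x y = 0 \<Longrightarrow> B y x = 0"
begin

lemma add_left: "B (x + y) z = B x z + B y z"
  using linear_left[of z] by (simp add: Vector_Spaces.linear_iff)

lemma scale_left: "B (c *s x) z = c * B x z"
  using linear_left[of z] by (simp add: Vector_Spaces.linear_iff)

lemma zero_left [simp]: "B 0 z = 0"
  using scale_left[of 0 0 z] by simp

lemma diff_left: "B (x - y) z = B x z - B y z"
  using add_left[of "x - y" y z] by simp

lemma orthogonal_commute: "B x y = 0 \<longleftrightarrow> B y x = 0"
  using reflexive by blast

lemma span_subset_perp_iff: "vec.span {u} \<subseteq> perp B (vec.span {v}) \<longleftrightarrow> B v u = 0"
proof
  assume "vec.span {u} \<subseteq> perp B (vec.span {v})"
  then show "B v u = 0"
    unfolding perp_def using vec.span_base[of u "{u}"] vec.span_base[of v "{v}"] by blast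
next
  assume "B v u = 0"
  \<comment> \<open>The scalar \<open>e\<close> sits in the second argument: swap, pull it out on
    the left, and swap back.\<close>
  then have "B (c *s v) (e *s u) = 0" for c e
    using orthogonal_commute[of v "e *s u"] orthogonal_commute[of v u] by (simp add: scale_left)
  then show "vec.span {u} \<subseteq> perp B (vec.span {v})"
    by (auto simp: perp_def vec.span_singleton)
qed

lemma span_in_verts_iff: "vec.span {v} \<in> polarity_verts B \<longleftrightarrow> B v v \<noteq> 0"
proof -
  have "vec.span {v} \<in> points" if "B v v \<noteq> 0"
  proof -
    have "v \<noteq> 0" using that by auto
    then show ?thesis using points_iff by blast
  qed
  then show ?thesis
    unfolding polarity_verts_def isotropic_point_def using span_subset_perp_iff[of v v] by blast
qed

lemma vertsE:
  assumes "x \<in> polarity_verts B"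
  obtains v where "x = vec.span {v}" "B v v \<noteq> 0"
proof -
  have "x \<in> points" using assms by (simp add: polarity_verts_def)
  then obtain v where "x = vec.span {v}" using points_iff by blast
  then show thesis using that assms span_in_verts_iff by blast
qed

lemma adj_span_iff:
  assumes "B u u \<noteq> 0" "B v v \<noteq> 0"
  shows "polarity_adj B (vec.span {u}) (vec.span {v}) \<longleftrightarrow> B v u = 0"
  using assms by (simp add: polarity_adj_def span_in_verts_iff span_subset_perp_iff)

end

section \<open>A single subspace \<open>vec.span (insert p R)\<close> with radical
  \<open>R\<close>\<close>

locale radical_extension = reflexive_form B
  for B :: "('a::{field,finite}, 'n::finite) form" +
  fixes R :: "('a ^ 'n) set" and p :: "'a ^ 'n"
  assumes subspace_R: "vec.subspace R"
    and anisotropic: "B p p \<noteq> 0"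
    and R_orthogonal: "r \<in> R \<Longrightarrow> B r p = 0" "r \<in> R \<Longrightarrow> s \<in> R \<Longrightarrow> B r s = 0"
begin

abbreviation coset_point :: "'a ^ 'n \<Rightarrow> ('a ^ 'n) set" where
  "coset_point r \<equiv> vec.span {p + r}"

lemma R_orthogonal_coset:
  assumes "r \<in> R" "s \<in> R"
  shows "B r (p + s) = 0"
proof -
  have "B (p + s) r = 0"
    using R_orthogonal assms orthogonal_commute[of p r] by (simp add: add_left)
  then show ?thesis by (rule reflexive)
qed

text \<open>The summand \<open>B r (p + s)\<close> vanishes, and \<open>B p (p + s)\<close> is
  nonzero because the swapped value \<open>B (p + s) p\<close> equals \<open>B p p\<close>.\<close>

lemma form_coset:
  assumes "r \<in> R" "s \<in> R"
  shows "B (p + r) (p + s) \<noteq> 0"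
proof -
  have "B (p + s) p \<noteq> 0" using assms anisotropic R_orthogonal by (simp add: add_left)
  then have "B p (p + s) \<noteq> 0" using reflexive by blast
  then show ?thesis using R_orthogonal_coset[OF assms] by (simp add: add_left)
qed

lemma not_in_R: "p \<notin> R"
  using R_orthogonal anisotropic by blast

lemma inj_coset_point: "inj_on coset_point R"
proof
  fix r s assume r: "r \<in> R" and s: "s \<in> R" and eq: "coset_point r = coset_point s"
  have "p + r \<in> coset_point s" using eq vec.span_base[of "p + r" "{p + r}"] by simp
  then obtain c where c: "p + r = c *s (p + s)" by (auto simp: vec.span_singleton)
  \<comment> \<open>Pairing with \<open>p\<close> removes \<open>r\<close> and \<open>s\<close> and
    leaves \<open>B p p = c * B p p\<close>.\<close>
  then have "B (p + r) p = B (c *s (p + s)) p" by simp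
  then have "c = 1"
    using r s R_orthogonal anisotropic by (simp add: add_left scale_left)
  then show "r = s" using c by simp
qed

lemma coset_points_eq:
  "{x \<in> polarity_verts B. x \<subseteq> vec.span (insert p R) \<and> \<not> x \<subseteq> R} = coset_point ` R"
proof (intro set_eqI iffI)
  fix x assume "x \<in> {x \<in> polarity_verts B. x \<subseteq> vec.span (insert p R) \<and> \<not> x \<subseteq> R}"
  then have x: "x \<in> polarity_verts B" "x \<subseteq> vec.span (insert p R)" "\<not> x \<subseteq> R" by auto
  obtain v where v: "x = vec.span {v}" using x(1) vertsE by blast
  have "v \<in> vec.span (insert p R)" using x(2) v vec.span_base[of v "{v}"] by blast
  then obtain c where c: "v - c *s p \<in> R"
    using vec.span_breakdown_eq[of v p R] vec.span_eq_iff[THEN iffD2, OF subspace_R] by auto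
  have "c \<noteq> 0"
  proof
    assume "c = 0"
    then have "v \<in> R" using c by simp
    then show False using x(3) v vec.span_minimal[of "{v}" R] subspace_R by blast
  qed
  \<comment> \<open>Here \<open>c\<close> is the coefficient of \<open>p\<close> in \<open>v\<close>
    modulo \<open>R\<close>. Dividing \<open>v\<close> by it gives the generator of \<open>x\<close>
    that lies in the coset of \<open>p\<close>, and \<open>r\<close> is its component in
    \<open>R\<close>.\<close>
  define r where "r = inverse c *s (v - c *s p)"
  have r: "r \<in> R" unfolding r_def using c subspace_R vec.subspace_scale by blast
  have v': "p + r = inverse c *s v"
    using \<open>c \<noteq> 0\<close> by (simp add: r_def vec.scale_right_diff_distrib)
  have "v = c *s (p + r)" using \<open>c \<noteq> 0\<close> v' by simp
  then have "vec.span {v} = coset_point r"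
    using vec.span_image_scale[of "{p + r}" "\<lambda>_. c"] \<open>c \<noteq> 0\<close> by simp
  then show "x \<in> coset_point ` R" using r v by blast
next
  fix x assume "x \<in> coset_point ` R"
  then obtain r where r: "r \<in> R" "x = coset_point r" by blast
  have "p + r \<in> vec.span (insert p R)"
    using r by (intro vec.span_add vec.span_base) auto
  then have "x \<subseteq> vec.span (insert p R)" using r vec.span_minimal[of "{p + r}"] by simp
  moreover have "\<not> x \<subseteq> R"
  proof
    assume "x \<subseteq> R"
    then have "p + r \<in> R" using r vec.span_base[of "p + r" "{p + r}"] by blast
    then have "p + r - r \<in> R" using r(1) subspace_R vec.subspace_diff by blast
    then show False using not_in_R by simp
  qed
  moreover have "x \<in> polarity_verts B" using r form_coset span_in_verts_iff by blast
  ultimately show "x \<in> {x \<in> polarity_verts B. x \<subseteq> vec.span (insert p R) \<and> \<not> x \<subseteq> R}" by blast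
qed

lemma card_coset_points: "card (coset_point ` R) = card R"
  using card_image inj_coset_point by blast

lemma nbhd_coset_points:
  assumes "B v v \<noteq> 0"
  shows "nbhd (polarity_verts B) (polarity_adj B) (vec.span {v}) \<inter> coset_point ` R
    = coset_point ` {r \<in> R. B (p + r) v = 0}"
proof -
  have "coset_point r \<in> nbhd (polarity_verts B) (polarity_adj B) (vec.span {v})
      \<longleftrightarrow> B (p + r) v = 0" if "r \<in> R" for r
    using adj_span_iff[of v "p + r"] form_coset that assms
    by (simp add: nbhd_def span_in_verts_iff)
  then show ?thesis by blast
qed

lemma card_nbhd_coset_points:
  assumes "B v v \<noteq> 0"
  shows "card (nbhd (polarity_verts B) (polarity_adj B) (vec.span {v}) \<inter> coset_point ` R)
    = card {r \<in> R. B r v = - B p v}"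
proof -
  have "{r \<in> R. B (p + r) v = 0} = {r \<in> R. B r v = - B p v}"
    by (auto simp: add_left add_eq_0_iff)
  moreover have "inj_on coset_point {r \<in> R. B (p + r) v = 0}"
    using inj_coset_point by (rule inj_on_subset) auto
  ultimately show ?thesis
    using nbhd_coset_points[OF assms] by (simp add: card_image)
qed

lemma nbhd_coset_points_orthogonal:
  assumes "B v v \<noteq> 0" "\<And>r. r \<in> R \<Longrightarrow> B r v = 0"
  shows "nbhd (polarity_verts B) (polarity_adj B) (vec.span {v}) \<inter> coset_point ` R
    = (if B p v = 0 then coset_point ` R else {})"
  using nbhd_coset_points[OF assms(1)] assms(2) by (auto simp: add_left)

lemma nbhd_own_coset_points:
  assumes "r \<in> R"
  shows "nbhd (polarity_verts B) (polarity_adj B) (coset_point r) \<inter> coset_point ` R = {}"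
  using nbhd_coset_points[of "p + r"] form_coset assms by auto

end

section \<open>Fibres over \<open>R\<close>, splitting off the radical, and reflexivity of the given
  forms\<close>

context reflexive_form
begin

text \<open>Translation by a vector of \<open>R\<close> whose value is \<open>b - a\<close> carries
  one fibre onto the other. A multiple of \<open>s\<close> is such a vector, since
  \<open>B s v\<close> is invertible.\<close>

lemma card_fibres_eq:
  assumes "vec.subspace R" "s \<in> R" "B s v \<noteq> 0"
  shows "card {r \<in> R. B r v = a} = card {r \<in> R. B r v = b}"
proof -
  define t where "t = ((b - a) / B s v) *s s"
  have t: "t \<in> R" unfolding t_def using assms vec.subspace_scale by blast
  have Bt: "B t v = b - a" using assms(3) by (simp add: t_def scale_left)
  have "bij_betw (\<lambda>r. r + t) {r \<in> R. B r v = a} {r \<in> R. B r v = b}"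
  proof (rule bij_betw_byWitness[where f' = "\<lambda>r. r - t"])
    show "(\<lambda>r. r + t) ` {r \<in> R. B r v = a} \<subseteq> {r \<in> R. B r v = b}"
      using t assms(1) vec.subspace_add by (auto simp: add_left Bt)
    show "(\<lambda>r. r - t) ` {r \<in> R. B r v = b} \<subseteq> {r \<in> R. B r v = a}"
      using t assms(1) vec.subspace_diff by (auto simp: diff_left Bt)
  qed auto
  then show ?thesis by (rule bij_betw_same_card)
qed

text \<open>As \<open>R\<close> has codimension 1 in \<open>L\<close>, any \<open>p\<close> in
  \<open>L\<close> outside \<open>R\<close> generates \<open>L\<close> together with
  \<open>R\<close>. If such a \<open>p\<close> were isotropic, it would be orthogonal to
  \<open>R\<close> and to itself, hence to all of \<open>L\<close>, and so would lie in the radical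
  \<open>R\<close>.\<close>

lemma radical_hyperplane_decomposition:
  assumes "vec.subspace L" "R = L \<inter> perp B L"
    and "vec.subspace R" "vec.dim L = Suc (vec.dim R)"
  obtains p where "L = vec.span (insert p R)" "B p p \<noteq> 0" "\<And>r. r \<in> R \<Longrightarrow> B r p = 0"
proof -
  have RL: "R \<subseteq> L" using assms(2) by blast
  have "L \<noteq> R" using assms(4) by auto
  then obtain p where p: "p \<in> L" "p \<notin> R" using RL by blast
  have orth: "B r u = 0" if "r \<in> R" "u \<in> L" for r u
    using that assms(2) reflexive[of u r] by (auto simp: perp_def)
  have sub: "vec.span (insert p R) \<subseteq> L"
    using p RL assms(1) by (intro vec.span_minimal) auto
  have "p \<notin> vec.span R" using p assms(3) vec.span_eq_iff by blast
  then have "vec.dim (insert p R) = vec.dim L" by (simp add: vec.dim_insert assms(4))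
  then have L: "L = vec.span (insert p R)"
    using vec.subspace_dim_equal[OF vec.subspace_span assms(1) sub] by simp
  have "B p p \<noteq> 0"
  proof
    assume Bpp: "B p p = 0"
    have "B u p = 0" if u: "u \<in> L" for u
    proof -
      obtain c where c: "u - c *s p \<in> R"
        using u L vec.span_breakdown_eq[of u p R] vec.span_eq_iff[THEN iffD2, OF assms(3)] by auto
      then have "B (u - c *s p) p = 0" using orth p by blast
      then show ?thesis using Bpp by (simp add: diff_left scale_left)
    qed
    then show False using p assms(2) by (auto simp: perp_def)
  qed
  then show thesis using that[of p] L orth p by blast
qed

end

lemma classical_polar_space_reflexive:
  assumes "classical_polar_space d (B :: ('a::{field,finite}, 'n::finite) form)"
  shows "reflexive_form B"
proof -
  consider r where "hermitian_form r B" | Q where "quadratic_form Q" "B = polar_form Q"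
    using assms by (auto simp: classical_polar_space_def)
  then show ?thesis
  proof cases
    case 1
    \<comment> \<open>Vanishing passes from \<open>B x y\<close> to its power only for a positive
      exponent, because \<open>0 ^ 0 = 1\<close>.\<close>
    have "r \<noteq> 0"
    proof
      assume "r = 0"
      then have "CARD('a) = 0" using 1 by (simp add: hermitian_form_def)
      then show False by simp
    qed
    moreover have "B y x = B x y ^ r" for x y using 1 unfolding hermitian_form_def by blast
    ultimately have "B x y = 0 \<Longrightarrow> B y x = 0" for x y by (metis power_eq_0_iff gr0I)
    moreover have "Vector_Spaces.linear (*s) (*) (\<lambda>x. B x y)" for y
      using 1 unfolding hermitian_form_def by blast
    ultimately show ?thesis by (rule reflexive_form.intro[rotated])
  next
    case 2
    have "B x y = 0 \<Longrightarrow> B y x = 0" for x y by (simp add: 2 polar_form_def algebra_simps)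
    moreover have "Vector_Spaces.linear (*s) (*) (\<lambda>x. B x y)" for y
      using 2 by (simp add: quadratic_form_def)
    ultimately show ?thesis by (rule reflexive_form.intro[rotated])
  qed
qed

section \<open>Switching for two extensions of a common radical\<close>

lemma switching_set_radical_extensions:
  assumes "radical_extension B R p1" "radical_extension B R p2"
    and disj: "(\<lambda>r. vec.span {p1 + r}) ` R \<inter> (\<lambda>r. vec.span {p2 + r}) ` R = {}"
  shows "switching_set (polarity_verts B) (polarity_adj B)
    ((\<lambda>r. vec.span {p1 + r}) ` R) ((\<lambda>r. vec.span {p2 + r}) ` R)"
proof -
  interpret E1: radical_extension B R p1 by fact
  interpret E2: radical_extension B R p2 by fact
  let ?C1 = "E1.coset_point ` R" and ?C2 = "E2.coset_point ` R"
  let ?V = "polarity_verts B" and ?E = "polarity_adj B"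
  have V: "?C1 \<subseteq> ?V" "?C2 \<subseteq> ?V"
    using E1.form_coset E2.form_coset by (auto simp: E1.span_in_verts_iff)
  \<comment> \<open>After a swap the term from \<open>R\<close> splits off on the left and vanishes;
    adjacency only asks whether the value is zero, so the swap loses nothing.\<close>
  have cross1: "B p2 (p1 + r) = 0 \<longleftrightarrow> B p1 p2 = 0" if "r \<in> R" for r
    using that E1.orthogonal_commute[of p2 "p1 + r"] E2.R_orthogonal by (simp add: E1.add_left)
  have cross2: "B p1 (p2 + r) = 0 \<longleftrightarrow> B p1 p2 = 0" if "r \<in> R" for r
    using that E1.orthogonal_commute[of p1 "p2 + r"] E1.orthogonal_commute[of p1 p2]
      E1.R_orthogonal by (simp add: E1.add_left)
  \<comment> \<open>All neighbours inside the union lie in the other set, which is joined either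
    completely or not at all.\<close>
  let ?l = "if B p1 p2 = 0 then card R else 0"
  have deg1: "card (nbhd ?V ?E x \<inter> (?C1 \<union> ?C2)) = ?l" if x: "x \<in> ?C1" for x
  proof -
    obtain r where r: "r \<in> R" "x = E1.coset_point r" using x by blast
    have "nbhd ?V ?E x \<inter> (?C1 \<union> ?C2) = nbhd ?V ?E x \<inter> ?C2"
      using E1.nbhd_own_coset_points r by blast
    also have "\<dots> = (if B p1 p2 = 0 then ?C2 else {})"
      using E2.nbhd_coset_points_orthogonal[of "p1 + r"] E1.form_coset E1.R_orthogonal_coset
        cross1 r by simp
    finally show ?thesis using E2.card_coset_points by simp
  qed
  have deg2: "card (nbhd ?V ?E x \<inter> (?C1 \<union> ?C2)) = ?l" if x: "x \<in> ?C2" for x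
  proof -
    obtain r where r: "r \<in> R" "x = E2.coset_point r" using x by blast
    have "nbhd ?V ?E x \<inter> (?C1 \<union> ?C2) = nbhd ?V ?E x \<inter> ?C1"
      using E2.nbhd_own_coset_points r by blast
    also have "\<dots> = (if B p1 p2 = 0 then ?C1 else {})"
      using E1.nbhd_coset_points_orthogonal[of "p2 + r"] E2.form_coset E2.R_orthogonal_coset
        cross2 r by simp
    finally show ?thesis using E1.card_coset_points by simp
  qed
  have reg: "induced_regular ?V ?E ?C1 0" "induced_regular ?V ?E ?C2 0"
    using E1.nbhd_own_coset_points E2.nbhd_own_coset_points by (auto simp: induced_regular_def)
  have reg_Un: "induced_regular ?V ?E (?C1 \<union> ?C2) ?l"
    using deg1 deg2 unfolding induced_regular_def by blast
  have outside: "card (nbhd ?V ?E x \<inter> ?C1) = card (nbhd ?V ?E x \<inter> ?C2) \<or>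
      nbhd ?V ?E x \<inter> (?C1 \<union> ?C2) \<in> {?C1, ?C2}" if x: "x \<in> ?V" for x
  proof -
    obtain v where v: "x = vec.span {v}" "B v v \<noteq> 0" using x E1.vertsE by blast
    show ?thesis
    proof (cases "\<forall>r\<in>R. B r v = 0")
      \<comment> \<open>Each of the two sets lies wholly inside or wholly outside the neighbourhood.
        Both or neither gives equal counts, as the sets have equal size; exactly one gives the
        second alternative.\<close>
      case True
      then show ?thesis
        using E1.nbhd_coset_points_orthogonal[OF v(2)] E2.nbhd_coset_points_orthogonal[OF v(2)] v(1)
          E1.card_coset_points E2.card_coset_points
        by (simp add: Int_Un_distrib)
    next
      case False
      then obtain s where "s \<in> R" "B s v \<noteq> 0" by blast
      \<comment> \<open>The neighbours in the two sets correspond to two fibres of the same nonzero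
        functional on \<open>R\<close>.\<close>
      then have "card {r \<in> R. B r v = - B p1 v} = card {r \<in> R. B r v = - B p2 v}"
        by (rule E1.card_fibres_eq[OF E1.subspace_R])
      then show ?thesis
        using E1.card_nbhd_coset_points[OF v(2)] E2.card_nbhd_coset_points[OF v(2)] v(1) by simp
    qed
  qed
  show ?thesis
    unfolding switching_set_def
  proof (intro conjI)
    show "card ?C1 = card ?C2" using E1.card_coset_points E2.card_coset_points by simp
    show "\<exists>k. induced_regular ?V ?E ?C1 k \<and> induced_regular ?V ?E ?C2 k"
      using reg by (intro exI conjI)
    show "\<exists>l. induced_regular ?V ?E (?C1 \<union> ?C2) l"
      using reg_Un by (rule exI)
    show "\<forall>x \<in> ?V - (?C1 \<union> ?C2). card (nbhd ?V ?E x \<inter> ?C1) = card (nbhd ?V ?E x \<inter> ?C2) \<or>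
        nbhd ?V ?E x \<inter> (?C1 \<union> ?C2) \<in> {?C1, ?C2}"
    proof
      fix x assume "x \<in> ?V - (?C1 \<union> ?C2)"
      then have "x \<in> ?V" by (rule DiffD1)
      then show "card (nbhd ?V ?E x \<inter> ?C1) = card (nbhd ?V ?E x \<inter> ?C2) \<or>
        nbhd ?V ?E x \<inter> (?C1 \<union> ?C2) \<in> {?C1, ?C2}" by (rule outside)
    qed
  qed (fact V disj)+
qed

theorem theorem7:
  fixes B :: "('a::{field,finite}, 'n::finite) form"
    and d m :: nat
    and L1 L2 :: "('a ^ 'n) set"
    and C1 C2 :: "('a ^ 'n) set set"
  assumes "classical_polar_space d B"
    and "3 \<le> d"
    and "3 \<le> m" and "m \<le> d"
    and "vec.subspace L1" and "vec.dim L1 = m - 1" and "\<not> totally_isotropic B L1"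
    and "vec.subspace L2" and "vec.dim L2 = m - 1" and "\<not> totally_isotropic B L2"
    and "vec.dim (L1 \<inter> L2) = m - 2"
    and "L1 \<inter> L2 = L1 \<inter> perp B L1"
    and "L1 \<inter> L2 = L2 \<inter> perp B L2"
    and "C1 = {x \<in> polarity_verts B. x \<subseteq> L1 \<and> \<not> x \<subseteq> L2}"
    and "C2 = {x \<in> polarity_verts B. x \<subseteq> L2 \<and> \<not> x \<subseteq> L1}"
  shows "switching_set (polarity_verts B) (polarity_adj B) C1 C2"
proof -
  interpret reflexive_form B using assms(1) by (rule classical_polar_space_reflexive)
  define R where "R = L1 \<inter> L2"
  have R: "vec.subspace R" unfolding R_def using assms vec.subspace_inter by blast
  \<comment> \<open>With truncated subtraction, \<open>m - 1 = Suc (m - 2)\<close> relies on the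
    lower bound for \<open>m\<close>.\<close>
  have dims: "vec.dim L1 = Suc (vec.dim R)" "vec.dim L2 = Suc (vec.dim R)"
    using assms by (auto simp: R_def)
  obtain p1 where p1: "L1 = vec.span (insert p1 R)" "B p1 p1 \<noteq> 0" "\<And>r. r \<in> R \<Longrightarrow> B r p1 = 0"
    using radical_hyperplane_decomposition[of L1 R] assms R dims R_def by metis
  obtain p2 where p2: "L2 = vec.span (insert p2 R)" "B p2 p2 \<noteq> 0" "\<And>r. r \<in> R \<Longrightarrow> B r p2 = 0"
    using radical_hyperplane_decomposition[of L2 R] assms R dims R_def by metis
  have "B r s = 0" if "r \<in> R" "s \<in> R" for r s
    using that assms(12) by (auto simp: R_def perp_def)
  then have ext: "radical_extension B R p1" "radical_extension B R p2"
    using R p1 p2 by unfold_locales auto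
  \<comment> \<open>For a point inside one of the two subspaces, lying in the other is the same as
    lying in \<open>R\<close>; this is the form that \<open>coset_points_eq\<close>
    describes.\<close>
  have "C1 = {x \<in> polarity_verts B. x \<subseteq> L1 \<and> \<not> x \<subseteq> R}"
    "C2 = {x \<in> polarity_verts B. x \<subseteq> L2 \<and> \<not> x \<subseteq> R}"
    unfolding assms(14,15) R_def by auto
  then have "C1 = (\<lambda>r. vec.span {p1 + r}) ` R" "C2 = (\<lambda>r. vec.span {p2 + r}) ` R"
    using ext[THEN radical_extension.coset_points_eq] unfolding p1(1)[symmetric] p2(1)[symmetric]
    by simp_all
  moreover have "C1 \<inter> C2 = {}" using assms(14,15) by blast
  ultimately show ?thesis using switching_set_radical_extensions[OF ext] by simp
qed

end
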